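(* (i) $\mathrm{ex}_<(n,P_5^{1342})=\Omega(n\log n)$, and (ii) $\mathrm{ex}_<(n,P_5^{2143})=\Theta(n\log n)$.
   Context: Edge-ordered graph: finite simple graph with a linear order on its edges; isomorphisms preserve order; subgraphs carry induced order; $\mathrm{ex}_<(n,H)$ is the maximum number of edges of an edge-ordered graph on $n$ vertices with no subgraph isomorphic to $H$. Notation: $P_k^{a_1\dots a_{k-1}}$ is the path $v_1\dots v_k$ where edge $v_iv_{i+1}$ has label $a_i$ and edges are ordered by label. *)

theory Defs
  imports Complex_Main "HOL-Library.Landau_Symbols"
begin

record 'a eograph =
  verts :: "'a set"
  edges :: "'a set set"
  eord :: "'a set rel"

definition edge_ordered_graph :: "'a eograph \<Rightarrow> bool" where
  "edge_ordered_graph G \<longleftrightarrow>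
     finite (verts G) \<and>
     edges G \<subseteq> {e. e \<subseteq> verts G \<and> card e = 2} \<and>
     linear_order_on (edges G) (eord G)"

definition eo_subgraph :: "'a eograph \<Rightarrow> 'a eograph \<Rightarrow> bool" where
  "eo_subgraph H G \<longleftrightarrow>
     edge_ordered_graph H \<and> edge_ordered_graph G \<and>
     verts H \<subseteq> verts G \<and> edges H \<subseteq> edges G \<and>
     eord H = eord G \<inter> (edges H \<times> edges H)"

definition eo_isomorphic :: "'a eograph \<Rightarrow> 'b eograph \<Rightarrow> bool" where
  "eo_isomorphic G H \<longleftrightarrow>
     (\<exists>f. bij_betw f (verts G) (verts H) \<and>
          (\<forall>u\<in>verts G. \<forall>v\<in>verts G. {u, v} \<in> edges G \<longleftrightarrow> {f u, f v} \<in> edges H) \<and>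
          (\<forall>e\<in>edges G. \<forall>e'\<in>edges G. (e, e') \<in> eord G \<longleftrightarrow> (f ` e, f ` e') \<in> eord H))"

definition eo_contains :: "'a eograph \<Rightarrow> 'b eograph \<Rightarrow> bool" where
  "eo_contains G H \<longleftrightarrow> (\<exists>G'. eo_subgraph G' G \<and> eo_isomorphic G' H)"

text \<open>
  Every finite graph has an isomorphic copy with vertices in \<^typ>\<open>nat\<close>, so host graphs
  are taken over \<^typ>\<open>nat\<close>. The \<^const>\<open>Max\<close> is over a finite set, which is nonempty
  as soon as the forbidden graph has an edge (see below).
\<close>

definition ex_lt_values :: "nat \<Rightarrow> 'b eograph \<Rightarrow> nat set" where
  "ex_lt_values n H =
     {card (edges G) | G :: nat eograph.
        edge_ordered_graph G \<and> card (verts G) = n \<and> \<not> eo_contains G H}"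

definition ex_lt :: "nat \<Rightarrow> 'b eograph \<Rightarrow> nat" where
  "ex_lt n H = Max (ex_lt_values n H)"

text \<open>
  The path with edge labels \<open>as\<close>, where the labels are assumed distinct. Vertices are
  indexed from 0, so the edge with label \<open>as ! i\<close> joins \<open>i\<close> and \<open>Suc i\<close>.
\<close>

definition eo_path :: "nat list \<Rightarrow> nat eograph" where
  "eo_path as =
     \<lparr>verts = {0..length as},
      edges = {{i, Suc i} | i. i < length as},
      eord = {({i, Suc i}, {j, Suc j}) | i j. i < length as \<and> j < length as \<and> as ! i \<le> as ! j}\<rparr>"

lemma path_edge_inject: "{i, Suc i} = {j, Suc j} \<longleftrightarrow> i = j"
  by (auto simp: doubleton_eq_iff)

lemma edge_ordered_graph_eo_path:
  assumes "distinct as"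
  shows "edge_ordered_graph (eo_path as)"
proof -
  let ?E = "edges (eo_path as)" and ?r = "eord (eo_path as)"
  have "?r \<subseteq> ?E \<times> ?E" "refl_on ?E ?r"
    by (auto simp: eo_path_def refl_on_def)
  moreover have "trans ?r"
  proof (rule transI)
    fix e e' e''
    assume "(e, e') \<in> ?r" "(e', e'') \<in> ?r"
    then obtain i j j' k where
      "e = {i, Suc i}" "e' = {j, Suc j}" "e' = {j', Suc j'}" "e'' = {k, Suc k}"
      "i < length as" "k < length as" "as ! i \<le> as ! j" "as ! j' \<le> as ! k"
      by (auto simp: eo_path_def)
    moreover from this have "j = j'"
      by (metis path_edge_inject)
    ultimately have "e = {i, Suc i} \<and> e'' = {k, Suc k} \<and> i < length as \<and> k < length as \<and> as ! i \<le> as ! k"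
      by auto
    then show "(e, e'') \<in> ?r"
      unfolding eo_path_def by auto
  qed
  moreover have "antisym ?r"
  proof (rule antisymI)
    fix e e'
    assume "(e, e') \<in> ?r" "(e', e) \<in> ?r"
    then obtain i j i' j' where *:
      "e = {i, Suc i}" "e' = {j, Suc j}" "e' = {j', Suc j'}" "e = {i', Suc i'}"
      "i < length as" "j < length as" "as ! i \<le> as ! j" "as ! j' \<le> as ! i'"
      by (simp add: eo_path_def) blast
    then have "i = i'" "j = j'"
      by (metis path_edge_inject)+
    with * have "i = j"
      using nth_eq_iff_index_eq[OF assms, of i j] by simp
    with * show "e = e'"
      by simp
  qed
  moreover have "total_on ?E ?r"
    by (auto simp: eo_path_def total_on_def path_edge_inject)
  moreover have "finite (verts (eo_path as))" "?E \<subseteq> {e. e \<subseteq> verts (eo_path as) \<and> card e = 2}"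
    by (auto simp: eo_path_def)
  ultimately show ?thesis
    by (simp add: edge_ordered_graph_def order_on_defs)
qed

lemma finite_ex_lt_values: "finite (ex_lt_values n H)"
proof -
  have "card (edges G) \<le> 2 ^ n" if "edge_ordered_graph G" "card (verts G) = n"
    for G :: "nat eograph"
  proof -
    have "edges G \<subseteq> Pow (verts G)" "finite (verts G)"
      using that by (auto simp: edge_ordered_graph_def)
    then show ?thesis
      using card_mono[of "Pow (verts G)" "edges G"] that by (simp add: card_Pow)
  qed
  then have "ex_lt_values n H \<subseteq> {..2 ^ n}"
    by (auto simp: ex_lt_values_def)
  then show ?thesis
    using finite_subset by blast
qed

lemma ex_lt_values_nonempty:
  assumes "edge_ordered_graph H" "edges H \<noteq> {}"
  shows "ex_lt_values n H \<noteq> {}"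
proof -
  let ?G = "\<lparr>verts = {..<n}, edges = {}, eord = {}\<rparr> :: nat eograph"
  obtain e where e: "e \<in> edges H" "e \<subseteq> verts H" "card e = 2"
    using assms by (auto simp: edge_ordered_graph_def)
  then obtain x y where xy: "e = {x, y}"
    by (auto simp: card_2_iff)
  have "\<not> eo_contains ?G H"
  proof
    assume "eo_contains ?G H"
    then obtain G' :: "nat eograph" and f where "edges G' = {}" and f: "bij_betw f (verts G') (verts H)"
      "\<forall>u\<in>verts G'. \<forall>v\<in>verts G'. {u, v} \<in> edges G' \<longleftrightarrow> {f u, f v} \<in> edges H"
      by (auto simp: eo_contains_def eo_subgraph_def eo_isomorphic_def)
    moreover obtain u v where "u \<in> verts G'" "v \<in> verts G'" "f u = x" "f v = y"
      using bij_betw_imp_surj_on[OF f(1)] e(2) xy by (metis imageE insert_subset)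
    ultimately show False
      using e xy by auto
  qed
  moreover have "edge_ordered_graph ?G"
    by (simp add: edge_ordered_graph_def)
  ultimately show ?thesis
    by (auto simp: ex_lt_values_def intro!: exI[of _ ?G])
qed

end

theory Submission
  imports Defs
begin

text \<open>
  Lower bounds: the hypercube on \<open>2 ^ k\<close> vertices consists of two subcubes and a perfect
  matching between them. Ordering the edges recursively as low subcube, matching, high subcube
  avoids 2143; ordering them as low subcube, high subcube, matching avoids 1342. In both cases a
  path using matching edges (no two of which are adjacent) has the wrong order.

  Upper bound for 2143: number the edges by their order. Every vertex \<open>x\<close> has a threshold \<open>T x\<close>
  such that for each edge \<open>xy\<close> with label \<open>l\<close> at most two edges at \<open>y\<close> have a label strictly between
  \<open>l\<close> and \<open>T x\<close>. Let \<open>T x \<le> T y\<close>. If \<open>l\<close> lies outside the open interval from \<open>T x\<close> to \<open>T y\<close>, then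
  it is one of a bounded number of labels next to the threshold of \<open>x\<close> or \<open>y\<close>. Otherwise, if \<open>l\<close> is
  at most the midpoint, the third next label at \<open>x\<close> is at least \<open>T y\<close>, so its distance to \<open>T x\<close>
  is at least doubled; symmetrically at \<open>y\<close>. Hence every vertex is charged for only
  logarithmically many edges.
\<close>

section \<open>Copies of paths\<close>

text \<open>A copy of the path, recorded by its vertex sequence. The order condition is an
  equivalence over all pairs of positions, so strict comparisons come from the pairs where it
  fails.\<close>

definition path_embedding :: "'a eograph \<Rightarrow> nat list \<Rightarrow> 'a list \<Rightarrow> bool" where
  "path_embedding G as vs \<longleftrightarrow>
     distinct vs \<and> length vs = Suc (length as) \<and> set vs \<subseteq> verts G \<and>
     (\<forall>i<length as. {vs ! i, vs ! Suc i} \<in> edges G) \<and>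
     (\<forall>i<length as. \<forall>j<length as.
        ({vs ! i, vs ! Suc i}, {vs ! j, vs ! Suc j}) \<in> eord G \<longleftrightarrow> as ! i \<le> as ! j)"

lemma eord_eo_path_iff:
  assumes "i < length as" "j < length as"
  shows "({i, Suc i}, {j, Suc j}) \<in> eord (eo_path as) \<longleftrightarrow> as ! i \<le> as ! j"
  using assms by (auto simp: eo_path_def path_edge_inject)

text \<open>The vertex sequence is the inverse isomorphism evaluated at
  \<open>0, ..., length as\<close>.\<close>

lemma eo_contains_path_imp_embedding:
  assumes "eo_contains G (eo_path as)"
  shows "\<exists>vs. path_embedding G as vs"
proof -
  obtain G' f where sub: "eo_subgraph G' G"
    and f: "bij_betw f (verts G') (verts (eo_path as))"
    and E: "\<And>u v. u \<in> verts G' \<Longrightarrow> v \<in> verts G' \<Longrightarrow>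
              {u, v} \<in> edges G' \<longleftrightarrow> {f u, f v} \<in> edges (eo_path as)"
    and R: "\<And>e e'. e \<in> edges G' \<Longrightarrow> e' \<in> edges G' \<Longrightarrow>
              (e, e') \<in> eord G' \<longleftrightarrow> (f ` e, f ` e') \<in> eord (eo_path as)"
    using assms unfolding eo_contains_def eo_isomorphic_def by blast
  define g where "g = inv_into (verts G') f"
  have vp: "verts (eo_path as) = {0..length as}"
    by (simp add: eo_path_def)
  have g: "bij_betw g {0..length as} (verts G')"
    unfolding g_def using bij_betw_inv_into[OF f] vp by simp
  have fg: "f (g i) = i" if "i \<le> length as" for i
    unfolding g_def using f that vp by (simp add: bij_betw_inv_into_right)
  have gv: "g i \<in> verts G'" if "i \<le> length as" for i
    using g that by (auto simp: bij_betw_def)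
  have gE: "{g i, g (Suc i)} \<in> edges G'" if "i < length as" for i
    using that by (subst E) (auto simp: gv fg eo_path_def)
  have gR: "({g i, g (Suc i)}, {g j, g (Suc j)}) \<in> eord G' \<longleftrightarrow> as ! i \<le> as ! j"
    if "i < length as" "j < length as" for i j
    using that by (subst R) (auto simp: gE fg eord_eo_path_iff)
  have "inj_on g (set [0..<Suc (length as)])"
    using g by (simp add: bij_betw_def atLeast0AtMost lessThan_Suc_atMost atLeast0LessThan
        del: upt_Suc)
  then have "path_embedding G as (map g [0..<Suc (length as)])"
    unfolding path_embedding_def
    using gv gE gR sub
    by (auto simp: distinct_map eo_subgraph_def nth_append simp del: upt_Suc)
  then show ?thesis ..
qed

lemma linear_order_on_restrict:
  assumes "linear_order_on B r" "A \<subseteq> B"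
  shows "linear_order_on A (r \<inter> A \<times> A)"
  using assms
  unfolding linear_order_on_def partial_order_on_def preorder_on_def refl_on_def
    trans_def antisym_def total_on_def
  by blast

text \<open>The subgraph keeps only the edges of the path, with the restricted order. The
  isomorphism sends a vertex to its position in \<open>vs\<close>.\<close>

lemma path_embedding_imp_eo_contains:
  assumes G: "edge_ordered_graph G" and emb: "path_embedding G as vs"
  shows "eo_contains G (eo_path as)"
proof -
  define E' where "E' = {{vs ! i, vs ! Suc i} | i. i < length as}"
  define G' where "G' = G\<lparr>verts := set vs, edges := E', eord := eord G \<inter> E' \<times> E'\<rparr>"
  define f where "f = the_inv_into {..<length vs} ((!) vs)"
  have d: "distinct vs" and len: "length vs = Suc (length as)" and V: "set vs \<subseteq> verts G"
    and E: "E' \<subseteq> edges G"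
    and R: "\<And>i j. i < length as \<Longrightarrow> j < length as \<Longrightarrow>
      ({vs ! i, vs ! Suc i}, {vs ! j, vs ! Suc j}) \<in> eord G \<longleftrightarrow> as ! i \<le> as ! j"
    using emb by (auto simp: path_embedding_def E'_def)
  have inj: "inj_on ((!) vs) {..<length vs}"
    using d by (simp add: inj_on_nth)
  have fv: "f (vs ! i) = i" if "i < length vs" for i
    unfolding f_def using inj that by (simp add: the_inv_into_f_f)
  have f: "bij_betw f (set vs) {0..length as}"
    unfolding f_def using bij_betw_the_inv_into[OF bij_betw_nth[OF d refl refl]] len
    by (simp add: lessThan_Suc_atMost atLeast0AtMost)
  have E'V: "E' \<subseteq> {e. e \<subseteq> set vs \<and> card e = 2}"
    using d len by (auto simp: E'_def nth_eq_iff_index_eq)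
  have sub: "eo_subgraph G' G"
    using G E V E'V
    by (auto simp: eo_subgraph_def edge_ordered_graph_def G'_def intro: linear_order_on_restrict)
  have "{u, v} \<in> E' \<longleftrightarrow> {f u, f v} \<in> edges (eo_path as)" if uv: "u \<in> set vs" "v \<in> set vs" for u v
  proof -
    obtain i j where ij: "u = vs ! i" "v = vs ! j" "i < length vs" "j < length vs"
      using uv by (metis in_set_conv_nth)
    have "{vs ! i, vs ! j} = {vs ! l, vs ! Suc l} \<longleftrightarrow> {i, j} = {l, Suc l}" if "l < length as" for l
      using ij(3,4) d len that by (simp add: doubleton_eq_iff nth_eq_iff_index_eq)
    then show ?thesis
      using ij by (auto simp: E'_def eo_path_def fv)
  qed
  moreover have "(e, e') \<in> eord G' \<longleftrightarrow> (f ` e, f ` e') \<in> eord (eo_path as)"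
    if e: "e \<in> E'" "e' \<in> E'" for e e'
  proof -
    obtain i j where ij: "e = {vs ! i, vs ! Suc i}" "e' = {vs ! j, vs ! Suc j}"
      "i < length as" "j < length as"
      using e by (auto simp: E'_def)
    have "f ` e = {i, Suc i}" "f ` e' = {j, Suc j}"
      using ij len by (auto simp: fv)
    then show ?thesis
      using e ij R[OF ij(3,4)] eord_eo_path_iff[OF ij(3,4)] by (simp add: G'_def)
  qed
  ultimately have "eo_isomorphic G' (eo_path as)"
    unfolding eo_isomorphic_def using f by (auto simp: G'_def eo_path_def)
  with sub show ?thesis
    unfolding eo_contains_def by blast
qed

section \<open>Orderings of the hypercube\<close>

text \<open>The factors \<open>p\<close> and \<open>q\<close> place the labels of the high subcube and of the matching; \<open>4 ^ k\<close>
  exceeds all labels of a \<open>k\<close>-dimensional cube. Thus \<open>(p, q) = (2, 1)\<close> gives the order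
  low, matching, high, and \<open>(p, q) = (1, 2)\<close> gives the order low, high, matching.\<close>

fun cube_adj :: "nat \<Rightarrow> nat \<Rightarrow> nat \<Rightarrow> bool" where
  "cube_adj 0 u v \<longleftrightarrow> False"
| "cube_adj (Suc k) u v \<longleftrightarrow>
     (if u < 2 ^ k \<and> v < 2 ^ k then cube_adj k u v
      else if 2 ^ k \<le> u \<and> 2 ^ k \<le> v then cube_adj k (u - 2 ^ k) (v - 2 ^ k)
      else (u < 2 ^ k \<and> v = u + 2 ^ k) \<or> (v < 2 ^ k \<and> u = v + 2 ^ k))"

fun cube_label :: "nat \<Rightarrow> nat \<Rightarrow> nat \<Rightarrow> nat \<Rightarrow> nat \<Rightarrow> nat" where
  "cube_label p q 0 u v = 0"
| "cube_label p q (Suc k) u v =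
     (if u < 2 ^ k \<and> v < 2 ^ k then cube_label p q k u v
      else if 2 ^ k \<le> u \<and> 2 ^ k \<le> v then p * 4 ^ k + cube_label p q k (u - 2 ^ k) (v - 2 ^ k)
      else q * 4 ^ k + min u v)"

section \<open>Bounds and injectivity of the cube labels\<close>

lemma cube_adj_sym: "cube_adj k u v \<longleftrightarrow> cube_adj k v u"
proof (induction k arbitrary: u v)
  case (Suc k)
  show ?case
    using Suc.IH[of u v] Suc.IH[of "u - 2 ^ k" "v - 2 ^ k"] by auto
qed simp

lemma cube_label_sym: "cube_label p q k u v = cube_label p q k v u"
proof (induction k arbitrary: u v)
  case (Suc k)
  show ?case
    using Suc.IH[of u v] Suc.IH[of "u - 2 ^ k" "v - 2 ^ k"] by (auto simp: min.commute)
qed simp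

lemma cube_adj_less:
  assumes "cube_adj k u v"
  shows "u < 2 ^ k" "v < 2 ^ k" "u \<noteq> v"
proof -
  have "u < 2 ^ k \<and> v < 2 ^ k \<and> u \<noteq> v"
    using assms
  proof (induction k arbitrary: u v)
    case (Suc k)
    consider "u < 2 ^ k" "v < 2 ^ k" | "2 ^ k \<le> u" "2 ^ k \<le> v"
      | "u < 2 ^ k" "2 ^ k \<le> v" | "2 ^ k \<le> u" "v < 2 ^ k"
      by linarith
    then show ?case
    proof cases
      case 1
      then have "cube_adj k u v"
        using Suc.prems by simp
      from Suc.IH[OF this] show ?thesis
        by simp
    next
      case 2
      then have "cube_adj k (u - 2 ^ k) (v - 2 ^ k)"
        using Suc.prems by simp
      from Suc.IH[OF this] show ?thesis
        by auto
    qed (use Suc.prems in simp_all)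
  qed simp
  then show "u < 2 ^ k" "v < 2 ^ k" "u \<noteq> v"
    by simp_all
qed

text \<open>The three kinds of edges occupy blocks of length \<open>4 ^ k\<close>, and three such
  blocks fit below \<open>4 ^ Suc k\<close>. The matching fits into its block because
  \<open>2 ^ k \<le> 4 ^ k\<close>.\<close>

lemma cube_label_less:
  assumes "cube_adj k u v" "{p, q} = {1, 2}"
  shows "cube_label p q k u v < 4 ^ k"
  using assms(1)
proof (induction k arbitrary: u v)
  case (Suc k)
  have *: "(2::nat) ^ k \<le> 4 ^ k"
    by (rule power_mono) auto
  have pq: "(p = 1 \<and> q = 2) \<or> (p = 2 \<and> q = 1)"
    using assms(2) by (auto simp: doubleton_eq_iff)
  consider "u < 2 ^ k" "v < 2 ^ k" | "2 ^ k \<le> u" "2 ^ k \<le> v"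
    | "u < 2 ^ k" "2 ^ k \<le> v" | "2 ^ k \<le> u" "v < 2 ^ k"
    by linarith
  then show ?case
  proof cases
    case 1
    then show ?thesis
      using Suc.prems Suc.IH[of u v] by simp
  next
    case 2
    then have "cube_label p q k (u - 2 ^ k) (v - 2 ^ k) < 4 ^ k"
      using Suc.prems by (intro Suc.IH) simp
    with 2 pq show ?thesis
      by (elim disjE conjE) simp_all
  next
    case 3
    with pq * show ?thesis
      by (elim disjE conjE) simp_all
  next
    case 4
    with pq * show ?thesis
      by (elim disjE conjE) simp_all
  qed
qed simp

lemma cube_adj_Suc_cases:
  assumes "cube_adj (Suc k) u v" "{p, q} = {1, 2}"
  obtains (low) "u < 2 ^ k" "v < 2 ^ k" "cube_adj k u v"
      "cube_label p q (Suc k) u v = cube_label p q k u v" "cube_label p q k u v < 4 ^ k"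
  | (high) "2 ^ k \<le> u" "2 ^ k \<le> v" "cube_adj k (u - 2 ^ k) (v - 2 ^ k)"
      "cube_label p q (Suc k) u v = p * 4 ^ k + cube_label p q k (u - 2 ^ k) (v - 2 ^ k)"
      "cube_label p q k (u - 2 ^ k) (v - 2 ^ k) < 4 ^ k"
  | (up) "u < 2 ^ k" "v = u + 2 ^ k" "cube_label p q (Suc k) u v = q * 4 ^ k + u" "u < 4 ^ k"
  | (down) "v < 2 ^ k" "u = v + 2 ^ k" "cube_label p q (Suc k) u v = q * 4 ^ k + v" "v < 4 ^ k"
proof -
  have *: "(2::nat) ^ k \<le> 4 ^ k"
    by (rule power_mono) auto
  consider "u < 2 ^ k \<and> v < 2 ^ k" | "2 ^ k \<le> u \<and> 2 ^ k \<le> v"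
    | "u < 2 ^ k \<and> 2 ^ k \<le> v" | "2 ^ k \<le> u \<and> v < 2 ^ k"
    by linarith
  then show thesis
  proof cases
    case 1
    then show thesis
      using assms cube_label_less[of k u v p q] by (intro low) auto
  next
    case 2
    then show thesis
      using assms cube_label_less[of k "u - 2 ^ k" "v - 2 ^ k" p q] by (intro high) auto
  next
    case 3
    then show thesis
      using assms * by (intro up) (auto simp: min_def)
  next
    case 4
    then show thesis
      using assms * by (intro down) (auto simp: min_def)
  qed
qed

text \<open>The three blocks are disjoint, so a label reveals whether its edge is low, high or in
  the matching.\<close>

lemma cube_label_zone:
  assumes "cube_adj (Suc k) u v" "{p, q} = {1, 2}"
  shows "u < 2 ^ k \<and> v < 2 ^ k \<longleftrightarrow> cube_label p q (Suc k) u v < 4 ^ k" (is ?low)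
    and "\<not> u < 2 ^ k \<and> \<not> v < 2 ^ k \<longleftrightarrow>
      p * 4 ^ k \<le> cube_label p q (Suc k) u v \<and> cube_label p q (Suc k) u v < p * 4 ^ k + 4 ^ k" (is ?high)
    and "(u < 2 ^ k) \<noteq> (v < 2 ^ k) \<longleftrightarrow>
      q * 4 ^ k \<le> cube_label p q (Suc k) u v \<and> cube_label p q (Suc k) u v < q * 4 ^ k + 4 ^ k" (is ?cross)
proof -
  have "(p = 1 \<and> q = 2) \<or> (p = 2 \<and> q = 1)"
    using assms(2) by (auto simp: doubleton_eq_iff)
  then have "?low \<and> ?high \<and> ?cross"
    by (elim disjE conjE; use assms(1) in \<open>elim cube_adj_Suc_cases[OF _ assms(2)]\<close>)
      (simp_all del: cube_label.simps)
  then show ?low ?high ?cross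
    by blast+
qed

text \<open>Equal labels lie in the same block. Within a subcube induction applies; a matching edge
  is determined by its lower end, which is the offset in its block.\<close>

lemma cube_label_inj:
  assumes "cube_adj k u v" "cube_adj k x y" "{p, q} = {1, 2}"
    and "cube_label p q k u v = cube_label p q k x y"
  shows "{u, v} = {x, y}"
  using assms(1,2,4)
proof (induction k arbitrary: u v x y)
  case (Suc k)
  let ?l = "cube_label p q (Suc k)"
  note zone = cube_label_zone[OF Suc.prems(1) assms(3)] cube_label_zone[OF Suc.prems(2) assms(3)]
  consider "u < 2 ^ k \<and> v < 2 ^ k" | "\<not> u < 2 ^ k \<and> \<not> v < 2 ^ k"
    | "(u < 2 ^ k) \<noteq> (v < 2 ^ k)"
    by blast
  then show ?case
  proof cases
    case 1
    moreover from 1 have "x < 2 ^ k \<and> y < 2 ^ k"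
      using zone Suc.prems(3) by metis
    ultimately show ?thesis
      using Suc.prems Suc.IH[of u v x y] by simp
  next
    case 2
    moreover from 2 have *: "\<not> x < 2 ^ k \<and> \<not> y < 2 ^ k"
      using zone Suc.prems(3) by metis
    ultimately have "{u - 2 ^ k, v - 2 ^ k} = {x - 2 ^ k, y - 2 ^ k}"
      using Suc.prems Suc.IH[of "u - 2 ^ k" "v - 2 ^ k" "x - 2 ^ k" "y - 2 ^ k"] by simp
    then show ?thesis
      using * 2 by (auto simp: doubleton_eq_iff)
  next
    case 3
    then have *: "(x < 2 ^ k) \<noteq> (y < 2 ^ k)"
      using zone Suc.prems(3) by metis
    have cross: "{a, b} = {min a b, min a b + 2 ^ k} \<and> ?l a b = q * 4 ^ k + min a b"
      if "cube_adj (Suc k) a b" "(a < 2 ^ k) \<noteq> (b < 2 ^ k)" for a b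
      using that(1) by (rule cube_adj_Suc_cases[OF _ assms(3)])
        (use that(2) in \<open>simp_all add: insert_commute del: cube_label.simps\<close>)
    show ?thesis
      using cross[OF Suc.prems(1) 3] cross[OF Suc.prems(2) *] Suc.prems(3) by simp
  qed
qed simp

section \<open>Exclusion of the two forbidden paths from the cubes\<close>

text \<open>Every vertex has a single partner in the other half, so two matching edges at
  \<open>b\<close> would give \<open>a = c\<close>.\<close>

lemma cube_adj_cross_unique:
  assumes "cube_adj (Suc k) a b" "cube_adj (Suc k) b c" "a \<noteq> c"
  shows "(a < 2 ^ k \<longleftrightarrow> b < 2 ^ k) \<or> (b < 2 ^ k \<longleftrightarrow> c < 2 ^ k)"
proof (rule ccontr)
  assume "\<not> ?thesis"
  then consider "a < 2 ^ k" "c < 2 ^ k" "2 ^ k \<le> b" | "2 ^ k \<le> a" "2 ^ k \<le> c" "b < 2 ^ k"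
    by linarith
  then show False
    using assms by cases auto
qed

text \<open>On a path within one half all labels are shifted by the same \<open>r\<close>, either
  \<open>0\<close> or \<open>p * 4 ^ k\<close>, so its order pattern survives in dimension
  \<open>k\<close>.\<close>

lemma cube_free_step:
  assumes adj: "cube_adj (Suc k) a b" "cube_adj (Suc k) b c" "cube_adj (Suc k) c d" "cube_adj (Suc k) d e"
    and dist: "distinct [a, b, c, d, e]"
    and same: "(a < 2 ^ k \<longleftrightarrow> b < 2 ^ k) \<and> (b < 2 ^ k \<longleftrightarrow> c < 2 ^ k) \<and>
      (c < 2 ^ k \<longleftrightarrow> d < 2 ^ k) \<and> (d < 2 ^ k \<longleftrightarrow> e < 2 ^ k)"
  obtains a' b' c' d' e' r where
    "cube_adj k a' b'" "cube_adj k b' c'" "cube_adj k c' d'" "cube_adj k d' e'"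
    "distinct [a', b', c', d', e']"
    "cube_label p q (Suc k) a b = r + cube_label p q k a' b'"
    "cube_label p q (Suc k) b c = r + cube_label p q k b' c'"
    "cube_label p q (Suc k) c d = r + cube_label p q k c' d'"
    "cube_label p q (Suc k) d e = r + cube_label p q k d' e'"
proof (cases "a < 2 ^ k")
  case True
  then show thesis
    using adj dist same by (intro that[of a b c d e 0]) simp_all
next
  case False
  then have "2 ^ k \<le> a" "2 ^ k \<le> b" "2 ^ k \<le> c" "2 ^ k \<le> d" "2 ^ k \<le> e"
    using same by auto
  then show thesis
    using adj dist
    by (intro that[of "a - 2 ^ k" "b - 2 ^ k" "c - 2 ^ k" "d - 2 ^ k" "e - 2 ^ k" "p * 4 ^ k"])
      (simp_all add: eq_diff_iff)
qed

text \<open>If \<open>b c\<close> is in the matching, its two neighbouring edges lie in opposite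
  halves, so one is low and has a smaller label, although \<open>b c\<close> is the minimum. Dually,
  \<open>c d\<close> as maximum cannot be in the matching. If \<open>a b\<close> is, then
  \<open>b c\<close> is low and \<open>c d\<close> has to cross; if \<open>d e\<close> is, then
  \<open>c d\<close> is high and \<open>b c\<close> has to cross. So the path stays in one half and
  induction applies.\<close>

lemma cube_free_2143:
  assumes "cube_adj k a b" "cube_adj k b c" "cube_adj k c d" "cube_adj k d e"
    and "distinct [a, b, c, d, e]"
    and "cube_label 2 1 k b c < cube_label 2 1 k a b"
    and "cube_label 2 1 k a b < cube_label 2 1 k d e"
    and "cube_label 2 1 k d e < cube_label 2 1 k c d"
  shows False
  using assms
proof (induction k arbitrary: a b c d e)
  case (Suc k)
  have pq: "{2, 1} = {1, 2 :: nat}"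
    by auto
  note zone = Suc.prems(1-4)[THEN cube_label_zone(1), OF pq]
    Suc.prems(1-4)[THEN cube_label_zone(2), OF pq]
    Suc.prems(1-4)[THEN cube_label_zone(3), OF pq]
  have cross: "(a < 2 ^ k \<longleftrightarrow> b < 2 ^ k) \<or> (b < 2 ^ k \<longleftrightarrow> c < 2 ^ k)"
    "(b < 2 ^ k \<longleftrightarrow> c < 2 ^ k) \<or> (c < 2 ^ k \<longleftrightarrow> d < 2 ^ k)"
    "(c < 2 ^ k \<longleftrightarrow> d < 2 ^ k) \<or> (d < 2 ^ k \<longleftrightarrow> e < 2 ^ k)"
    using Suc.prems(1-5) by (intro cube_adj_cross_unique; simp)+
  have "(a < 2 ^ k \<longleftrightarrow> b < 2 ^ k) \<and> (b < 2 ^ k \<longleftrightarrow> c < 2 ^ k) \<and>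
      (c < 2 ^ k \<longleftrightarrow> d < 2 ^ k) \<and> (d < 2 ^ k \<longleftrightarrow> e < 2 ^ k)"
    using cross zone Suc.prems(6-8)
    by (cases "a < 2 ^ k"; cases "b < 2 ^ k"; cases "c < 2 ^ k"; cases "d < 2 ^ k"; cases "e < 2 ^ k";
        simp del: cube_label.simps; linarith)
  then show ?case
    by (rule cube_free_step[OF Suc.prems(1-5), where p = 2 and q = 1]) (use Suc.IH Suc.prems(6-8) in fastforce)
qed simp

text \<open>Matching labels are now the largest. Each of \<open>a b\<close>, \<open>b c\<close>,
  \<open>d e\<close> has an adjacent edge with larger label, which would be in the matching as well.
  If only \<open>c d\<close> crosses, then \<open>a b\<close> and \<open>b c\<close> share a half,
  yet \<open>d e\<close> from the other half lies between them in the order.\<close>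

lemma cube_free_1342:
  assumes "cube_adj k a b" "cube_adj k b c" "cube_adj k c d" "cube_adj k d e"
    and "distinct [a, b, c, d, e]"
    and "cube_label 1 2 k a b < cube_label 1 2 k d e"
    and "cube_label 1 2 k d e < cube_label 1 2 k b c"
    and "cube_label 1 2 k b c < cube_label 1 2 k c d"
  shows False
  using assms
proof (induction k arbitrary: a b c d e)
  case (Suc k)
  have pq: "{1, 2} = {1, 2 :: nat}"
    by auto
  note zone = Suc.prems(1-4)[THEN cube_label_zone(1), OF pq]
    Suc.prems(1-4)[THEN cube_label_zone(2), OF pq]
    Suc.prems(1-4)[THEN cube_label_zone(3), OF pq]
  have cross: "(a < 2 ^ k \<longleftrightarrow> b < 2 ^ k) \<or> (b < 2 ^ k \<longleftrightarrow> c < 2 ^ k)"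
    "(b < 2 ^ k \<longleftrightarrow> c < 2 ^ k) \<or> (c < 2 ^ k \<longleftrightarrow> d < 2 ^ k)"
    "(c < 2 ^ k \<longleftrightarrow> d < 2 ^ k) \<or> (d < 2 ^ k \<longleftrightarrow> e < 2 ^ k)"
    using Suc.prems(1-5) by (intro cube_adj_cross_unique; simp)+
  have "(a < 2 ^ k \<longleftrightarrow> b < 2 ^ k) \<and> (b < 2 ^ k \<longleftrightarrow> c < 2 ^ k) \<and>
      (c < 2 ^ k \<longleftrightarrow> d < 2 ^ k) \<and> (d < 2 ^ k \<longleftrightarrow> e < 2 ^ k)"
    using cross zone Suc.prems(6-8)
    by (cases "a < 2 ^ k"; cases "b < 2 ^ k"; cases "c < 2 ^ k"; cases "d < 2 ^ k"; cases "e < 2 ^ k";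
        simp del: cube_label.simps; linarith)
  then show ?case
    by (rule cube_free_step[OF Suc.prems(1-5), where p = 1 and q = 2]) (use Suc.IH Suc.prems(6-8) in fastforce)
qed simp

section \<open>The cube as an edge-ordered graph and its number of edges\<close>

definition cube_edges :: "nat \<Rightarrow> nat set set" where
  "cube_edges k = {{u, v} | u v. cube_adj k u v}"

text \<open>For \<open>n\<close> above \<open>2 ^ k\<close> the further vertices are isolated; this
  padding handles all \<open>n\<close> that are not powers of two.\<close>

definition cube_graph :: "nat \<Rightarrow> nat \<Rightarrow> nat \<Rightarrow> nat \<Rightarrow> nat eograph" where
  "cube_graph p q k n =
     \<lparr>verts = {..<n}, edges = cube_edges k,
      eord = {({u, v}, {x, y}) | u v x y. cube_adj k u v \<and> cube_adj k x y \<and>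
                cube_label p q k u v \<le> cube_label p q k x y}\<rparr>"

lemma doubleton_in_cube_edges_iff: "{u, v} \<in> cube_edges k \<longleftrightarrow> cube_adj k u v"
  unfolding cube_edges_def using cube_adj_sym by (auto simp: doubleton_eq_iff)

lemma cube_graph_eord_iff:
  "({u, v}, {x, y}) \<in> eord (cube_graph p q k n) \<longleftrightarrow>
     cube_adj k u v \<and> cube_adj k x y \<and> cube_label p q k u v \<le> cube_label p q k x y"
proof
  assume "({u, v}, {x, y}) \<in> eord (cube_graph p q k n)"
  then obtain u' v' x' y' where "{u, v} = {u', v'}" "{x, y} = {x', y'}" "cube_adj k u' v'"
    "cube_adj k x' y'" "cube_label p q k u' v' \<le> cube_label p q k x' y'"
    unfolding cube_graph_def by auto
  then show "cube_adj k u v \<and> cube_adj k x y \<and> cube_label p q k u v \<le> cube_label p q k x y"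
    using cube_adj_sym[of k u v] cube_adj_sym[of k x y]
      cube_label_sym[of p q k u v] cube_label_sym[of p q k x y]
    by (auto simp: doubleton_eq_iff)
qed (auto simp: cube_graph_def)

text \<open>Antisymmetry is injectivity of the labels; the other order laws are inherited from the
  order on numbers.\<close>

lemma edge_ordered_graph_cube_graph:
  assumes "{p, q} = {1, 2}" "2 ^ k \<le> n"
  shows "edge_ordered_graph (cube_graph p q k n)"
proof -
  let ?G = "cube_graph p q k n"
  have G: "verts ?G = {..<n}" "edges ?G = cube_edges k"
    by (simp_all add: cube_graph_def)
  have sub: "eord ?G \<subseteq> cube_edges k \<times> cube_edges k"
    by (auto simp: cube_graph_def cube_edges_def)
  have E: "\<exists>u v. e = {u, v} \<and> cube_adj k u v" if "e \<in> cube_edges k" for e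
    using that by (auto simp: cube_edges_def)
  have "refl_on (cube_edges k) (eord ?G)"
    unfolding refl_on_def using E cube_graph_eord_iff by blast
  moreover have "trans (eord ?G)"
  proof (rule transI)
    fix e f g assume ef: "(e, f) \<in> eord ?G" and fg: "(f, g) \<in> eord ?G"
    then have "e \<in> cube_edges k" "f \<in> cube_edges k" "g \<in> cube_edges k"
      using sub by auto
    then obtain a b c d x y where "e = {a, b}" "f = {c, d}" "g = {x, y}"
      using E by meson
    with ef fg show "(e, g) \<in> eord ?G"
      by (simp add: cube_graph_eord_iff)
  qed
  moreover have "antisym (eord ?G)"
  proof (rule antisymI)
    fix e f assume ef: "(e, f) \<in> eord ?G" and fe: "(f, e) \<in> eord ?G"
    then have "e \<in> cube_edges k" "f \<in> cube_edges k"
      using sub by auto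
    then obtain a b c d where "e = {a, b}" "f = {c, d}"
      using E by meson
    with ef fe show "e = f"
      using cube_label_inj[OF _ _ assms(1), of k a b c d] by (simp add: cube_graph_eord_iff)
  qed
  moreover have "total_on (cube_edges k) (eord ?G)"
  proof (rule total_onI)
    fix e f assume "e \<in> cube_edges k" "f \<in> cube_edges k"
    then obtain a b c d where "e = {a, b}" "f = {c, d}" "cube_adj k a b" "cube_adj k c d"
      using E by meson
    then show "(e, f) \<in> eord ?G \<or> (f, e) \<in> eord ?G"
      by (auto simp: cube_graph_eord_iff)
  qed
  moreover have "cube_edges k \<subseteq> {e. e \<subseteq> {..<n} \<and> card e = 2}"
    using assms(2) cube_adj_less by (fastforce dest!: E)
  ultimately show ?thesis
    using sub by (simp add: edge_ordered_graph_def order_on_defs G)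
qed

lemma cube_edges_Suc:
  "cube_edges (Suc k) = cube_edges k \<union> (`) ((+) (2 ^ k)) ` cube_edges k \<union> (\<lambda>u. {u, u + 2 ^ k}) ` {..<2 ^ k}"
  (is "_ = ?L \<union> ?H \<union> ?M")
proof (rule set_eqI)
  fix e
  show "e \<in> cube_edges (Suc k) \<longleftrightarrow> e \<in> ?L \<union> ?H \<union> ?M"
  proof
    assume "e \<in> cube_edges (Suc k)"
    then obtain u v where e: "e = {u, v}" and uv: "cube_adj (Suc k) u v"
      by (auto simp: cube_edges_def)
    consider "u < 2 ^ k" "v < 2 ^ k" | "2 ^ k \<le> u" "2 ^ k \<le> v"
      | "u < 2 ^ k" "2 ^ k \<le> v" | "2 ^ k \<le> u" "v < 2 ^ k"
      by linarith
    then show "e \<in> ?L \<union> ?H \<union> ?M"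
    proof cases
      case 1
      then show ?thesis
        using uv by (simp add: e doubleton_in_cube_edges_iff)
    next
      case 2
      then have "{u - 2 ^ k, v - 2 ^ k} \<in> cube_edges k"
        using uv by (simp add: doubleton_in_cube_edges_iff)
      moreover have "e = (+) (2 ^ k) ` {u - 2 ^ k, v - 2 ^ k}"
        using 2 by (simp add: e)
      ultimately show ?thesis
        by blast
    qed (use uv in \<open>auto simp: e\<close>)
  next
    assume "e \<in> ?L \<union> ?H \<union> ?M"
    then consider "e \<in> ?L" | "e \<in> ?H" | "e \<in> ?M"
      by blast
    then show "e \<in> cube_edges (Suc k)"
    proof cases
      case 1
      then obtain u v where "e = {u, v}" "cube_adj k u v"
        by (auto simp: cube_edges_def)
      then show ?thesis
        using cube_adj_less[of k u v] by (simp add: doubleton_in_cube_edges_iff)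
    next
      case 2
      then obtain u v where "e = {2 ^ k + u, 2 ^ k + v}" "cube_adj k u v"
        by (auto simp: cube_edges_def)
      then show ?thesis
        by (simp add: doubleton_in_cube_edges_iff)
    next
      case 3
      then obtain u where "e = {u, u + 2 ^ k}" "u < 2 ^ k"
        by auto
      then show ?thesis
        by (simp add: doubleton_in_cube_edges_iff)
    qed
  qed
qed

lemma cube_edges_subset: "e \<in> cube_edges k \<Longrightarrow> e \<subseteq> {..<2 ^ k} \<and> e \<noteq> {}"
  by (auto simp: cube_edges_def dest: cube_adj_less)

text \<open>Two copies of the smaller cube and \<open>2 ^ k\<close> matching edges are disjoint: an
  edge of a copy stays within one half, a matching edge does not.\<close>

lemma card_cube_edges: "2 * card (cube_edges k) = k * 2 ^ k"
proof (induction k)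
  case 0
  show ?case
    by (simp add: cube_edges_def)
next
  case (Suc k)
  let ?L = "cube_edges k" and ?H = "(`) ((+) (2 ^ k)) ` cube_edges k"
    and ?M = "(\<lambda>u. {u, u + 2 ^ k}) ` {..<2 ^ k :: nat}"
  have fin: "finite ?L"
    by (rule finite_subset[of _ "Pow {..<2 ^ k}"]) (use cube_edges_subset in auto)
  have low: "e \<subseteq> {..<2 ^ k} \<and> e \<noteq> {}" if "e \<in> ?L" for e
    using cube_edges_subset that by blast
  have high: "e \<subseteq> {2 ^ k..} \<and> e \<noteq> {}" if "e \<in> ?H" for e
    using cube_edges_subset that by fastforce
  have disj: "?L \<inter> ?H = {}" "(?L \<union> ?H) \<inter> ?M = {}"
  proof -
    show "?L \<inter> ?H = {}"
    proof (rule ccontr)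
      assume "?L \<inter> ?H \<noteq> {}"
      then obtain e where "e \<in> ?L" "e \<in> ?H"
        by blast
      with low[of e] high[of e] have "e \<subseteq> {..<2 ^ k}" "e \<subseteq> {2 ^ k..}" "e \<noteq> {}"
        by blast+
      then show False
        by (meson atLeast_iff equals0I lessThan_iff not_less subsetD)
    qed
    have "\<not> {u, u + 2 ^ k} \<subseteq> {..<2 ^ k}" "u < 2 ^ k \<Longrightarrow> \<not> {u, u + 2 ^ k} \<subseteq> {2 ^ k..}" for u :: nat
      by auto
    then show "(?L \<union> ?H) \<inter> ?M = {}"
      using low high by blast
  qed
  have "card ?H = card ?L"
    by (intro card_image inj_onI) (simp add: inj_image_eq_iff)
  moreover have "card ?M = 2 ^ k"
    by (subst card_image) (auto simp: inj_on_def doubleton_eq_iff)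
  ultimately have "card (cube_edges (Suc k)) = card ?L + card ?L + 2 ^ k"
    unfolding cube_edges_Suc using fin disj by (simp add: card_Un_disjoint)
  then show ?case
    using Suc.IH by (simp add: algebra_simps)
qed

section \<open>The lower bounds\<close>

text \<open>Comparisons are given in both directions because a strict inequality between labels is
  the failure of the reverse one.\<close>

lemma path_embedding_4D:
  assumes "path_embedding G [p, q, r, s] vs"
  obtains a b c d e where "distinct [a, b, c, d, e]"
    "{a, b} \<in> edges G" "{b, c} \<in> edges G" "{c, d} \<in> edges G" "{d, e} \<in> edges G"
    "({a, b}, {b, c}) \<in> eord G \<longleftrightarrow> p \<le> q" "({b, c}, {a, b}) \<in> eord G \<longleftrightarrow> q \<le> p"
    "({a, b}, {d, e}) \<in> eord G \<longleftrightarrow> p \<le> s" "({d, e}, {a, b}) \<in> eord G \<longleftrightarrow> s \<le> p"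
    "({b, c}, {c, d}) \<in> eord G \<longleftrightarrow> q \<le> r" "({c, d}, {b, c}) \<in> eord G \<longleftrightarrow> r \<le> q"
    "({b, c}, {d, e}) \<in> eord G \<longleftrightarrow> q \<le> s" "({d, e}, {b, c}) \<in> eord G \<longleftrightarrow> s \<le> q"
    "({c, d}, {d, e}) \<in> eord G \<longleftrightarrow> r \<le> s" "({d, e}, {c, d}) \<in> eord G \<longleftrightarrow> s \<le> r"
proof -
  have "length vs = 5"
    using assms by (simp add: path_embedding_def)
  then obtain a b c d e where vs: "vs = [a, b, c, d, e]"
    by (auto simp: eval_nat_numeral length_Suc_conv)
  show thesis
    using assms by (intro that[of a b c d e])
      (simp_all add: path_embedding_def vs All_less_Suc)
qed

lemma ex_lt_ge:
  assumes "edge_ordered_graph G" "card (verts G) = n" "\<not> eo_contains G H"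
  shows "card (edges (G :: nat eograph)) \<le> ex_lt n H"
  unfolding ex_lt_def using assms
  by (intro Max_ge finite_ex_lt_values) (auto simp: ex_lt_values_def)

lemma cube_graph_free_2143: "\<not> eo_contains (cube_graph 2 1 k n) (eo_path [2, 1, 4, 3])"
proof
  assume "eo_contains (cube_graph 2 1 k n) (eo_path [2, 1, 4, 3])"
  then obtain vs where "path_embedding (cube_graph 2 1 k n) [2, 1, 4, 3] vs"
    using eo_contains_path_imp_embedding by blast
  then obtain a b c d e where "distinct [a, b, c, d, e]"
    "cube_adj k a b" "cube_adj k b c" "cube_adj k c d" "cube_adj k d e"
    "cube_label 2 1 k b c < cube_label 2 1 k a b"
    "cube_label 2 1 k a b < cube_label 2 1 k d e"
    "cube_label 2 1 k d e < cube_label 2 1 k c d"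
    by (rule path_embedding_4D) (force simp: cube_graph_eord_iff not_le simp del: distinct.simps)
  then show False
    using cube_free_2143 by blast
qed

lemma cube_graph_free_1342: "\<not> eo_contains (cube_graph 1 2 k n) (eo_path [1, 3, 4, 2])"
proof
  assume "eo_contains (cube_graph 1 2 k n) (eo_path [1, 3, 4, 2])"
  then obtain vs where "path_embedding (cube_graph 1 2 k n) [1, 3, 4, 2] vs"
    using eo_contains_path_imp_embedding by blast
  then obtain a b c d e where "distinct [a, b, c, d, e]"
    "cube_adj k a b" "cube_adj k b c" "cube_adj k c d" "cube_adj k d e"
    "cube_label 1 2 k a b < cube_label 1 2 k d e"
    "cube_label 1 2 k d e < cube_label 1 2 k b c"
    "cube_label 1 2 k b c < cube_label 1 2 k c d"
    by (rule path_embedding_4D) (force simp: cube_graph_eord_iff not_le simp del: distinct.simps)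
  then show False
    using cube_free_1342 by blast
qed

text \<open>The host graph is the largest cube that fits into \<open>n\<close> vertices; its
  dimension is about the binary logarithm of \<open>n\<close>.\<close>

lemma bigomega_if_cube_graph_free:
  assumes pq: "{p, q} = {1, 2}" and free: "\<And>k n. \<not> eo_contains (cube_graph p q k n) H"
  shows "(\<lambda>n. real (ex_lt n H)) \<in> \<Omega>(\<lambda>n. real n * ln (real n))"
\<comment> \<open>With \<open>2 ^ k \<le> n < 2 ^ (k + 1)\<close>, \<open>n * ln n\<close> is at
  most \<open>(2 * 2 ^ k) * (2 * k)\<close>, while \<open>k * 2 ^ k\<close> is at most
  \<open>2 * ex_lt n H\<close>; together this gives the factor 8.\<close>
proof (rule landau_omega.bigI[of "1 / 8"])
  show "eventually (\<lambda>n. 1 / 8 * norm (real n * ln (real n)) \<le> norm (real (ex_lt n H))) at_top"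
  proof (rule eventually_mono[OF eventually_ge_at_top[of 4]])
    fix n :: nat assume n: "4 \<le> n"
    obtain k where k: "2 ^ k \<le> n" "n < 2 ^ (k + 1)"
      using ex_power_ivl1[of 2 n] n by auto
    have "card (edges (cube_graph p q k n)) \<le> ex_lt n H"
      using edge_ordered_graph_cube_graph[OF pq k(1)] free
      by (intro ex_lt_ge) (auto simp: cube_graph_def)
    then have le: "k * 2 ^ k \<le> 2 * ex_lt n H"
      using card_cube_edges[of k] by (simp add: cube_graph_def)
    have "k \<noteq> 0"
      using n k(2) by (intro notI) simp
    moreover have "k \<noteq> 1"
      using n k(2) by (intro notI) simp
    ultimately have "2 \<le> k"
      by linarith
    have ln2: "ln (2 :: real) \<le> 1"
      using ln_le_minus_one[of "2 :: real"] by simp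
    have "real n \<le> real (2 * 2 ^ k)"
      unfolding of_nat_le_iff using k(2) by simp
    then have n2: "real n \<le> 2 * 2 ^ k"
      by simp
    then have "ln (real n) \<le> ln (2 ^ (k + 1))"
      using n by (intro ln_mono) simp_all
    also have "\<dots> = (real k + 1) * ln 2"
      by (subst ln_realpow) auto
    also have "\<dots> \<le> (real k + 1) * 1"
      using ln2 by (intro mult_left_mono) auto
    also have "\<dots> \<le> 2 * real k"
      using \<open>2 \<le> k\<close> by simp
    finally have ln: "ln (real n) \<le> 2 * real k" .
    have "real n * ln (real n) \<le> (2 * 2 ^ k) * (2 * real k)"
      using ln n2 n by (intro mult_mono) auto
    also have "\<dots> = 4 * real (k * 2 ^ k)"
      by simp
    also have "\<dots> \<le> 4 * real (2 * ex_lt n H)"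
      using le by (intro mult_left_mono of_nat_mono) auto
    finally show "1 / 8 * norm (real n * ln (real n)) \<le> norm (real (ex_lt n H))"
      using n by (simp add: abs_mult)
  qed
qed simp

section \<open>The upper bound\<close>

text \<open>Apply the bound at the maximum, which has all other elements below it.\<close>

lemma card_le_if_few_below:
  fixes S :: "int set"
  assumes "finite S" "\<And>x. x \<in> S \<Longrightarrow> card (S \<inter> {..<x}) \<le> k"
  shows "card S \<le> Suc k"
proof (cases "S = {}")
  case False
  then have M: "Max S \<in> S" "\<And>x. x \<in> S \<Longrightarrow> x \<le> Max S"
    using assms(1) by auto
  then have "S = insert (Max S) (S \<inter> {..<Max S})"
    by force
  then have "card S \<le> Suc (card (S \<inter> {..<Max S}))"
    by (metis card_insert_le_m1 card_insert_if finite_Int assms(1) le_refl Int_iff lessThan_iff less_irrefl)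
  with assms(2)[OF M(1)] show ?thesis
    by simp
qed simp

lemma card_le_if_few_above:
  fixes S :: "int set"
  assumes "finite S" "\<And>x. x \<in> S \<Longrightarrow> card (S \<inter> {x<..}) \<le> k"
  shows "card S \<le> Suc k"
proof (cases "S = {}")
  case False
  then have M: "Min S \<in> S" "\<And>x. x \<in> S \<Longrightarrow> Min S \<le> x"
    using assms(1) by auto
  then have "S = insert (Min S) (S \<inter> {Min S<..})"
    by force
  then have "card S \<le> Suc (card (S \<inter> {Min S<..}))"
    by (metis card_insert_le_m1 card_insert_if finite_Int assms(1) le_refl Int_iff greaterThan_iff less_irrefl)
  with assms(2)[OF M(1)] show ?thesis
    by simp
qed simp

text \<open>The interval splits into \<open>k\<close> dyadic blocks, each containing at most
  \<open>Suc c\<close> elements of \<open>S\<close>.\<close>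

lemma card_le_if_doubling:
  fixes S :: "int set"
  assumes "S \<subseteq> {0<..<2 ^ k}" "\<And>x. x \<in> S \<Longrightarrow> card (S \<inter> {x<..<2 * x}) \<le> c"
  shows "card S \<le> Suc c * k"
  using assms
proof (induction k arbitrary: S)
  case 0
  then have "S = {}"
    by force
  then show ?case
    by simp
next
  case (Suc k)
  have fin: "finite S"
    using Suc.prems(1) finite_subset by blast
  let ?A = "S \<inter> {0<..<2 ^ k}" and ?B = "S \<inter> {2 ^ k..}"
  have "card ?A \<le> Suc c * k"
  proof (rule Suc.IH)
    show "card (?A \<inter> {x<..<2 * x}) \<le> c" if "x \<in> ?A" for x
      by (rule le_trans[OF card_mono Suc.prems(2)]) (use fin that in auto)
  qed simp
  \<comment> \<open>All of \<open>?B\<close> lies below \<open>2 ^ Suc k\<close>, hence below the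
    double of any of its elements.\<close>
  moreover have "card ?B \<le> Suc c"
  proof (rule card_le_if_few_above)
    show "card (?B \<inter> {x<..}) \<le> c" if "x \<in> ?B" for x
      by (rule le_trans[OF card_mono Suc.prems(2)[of x]]) (use fin that Suc.prems(1) in fastforce)+
  qed (use fin in simp)
  moreover have "S = ?A \<union> ?B"
    using Suc.prems(1) by force
  then have "card S \<le> card ?A + card ?B"
    by (metis card_Un_le)
  ultimately show ?case
    by simp
qed

text \<open>In an application \<open>L\<close> is the set of labels at a vertex and \<open>t\<close> its threshold. Above \<open>t\<close>, the
  charged labels are those close to \<open>t\<close> in rank and those whose distance to \<open>t\<close> doubles
  within three steps; below \<open>t\<close> the same holds after reflection.\<close>

definition charged_above :: "int set \<Rightarrow> int \<Rightarrow> int set" where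
  "charged_above L t = {l \<in> L. t < l \<and> (card (L \<inter> {t<..<l}) \<le> 2 \<or> card (L \<inter> {l<..<2 * l - t}) \<le> 2)}"

definition charged :: "int set \<Rightarrow> int \<Rightarrow> int set" where
  "charged L t = (L \<inter> {t}) \<union> charged_above L t \<union> uminus ` charged_above (uminus ` L) (- t)"

lemma card_charged_above:
  assumes "finite L" "\<And>l. l \<in> L \<Longrightarrow> l - t < 2 ^ k"
  shows "card (charged_above L t) \<le> 3 + 3 * k"
proof -
  let ?A = "{l \<in> L. t < l \<and> card (L \<inter> {t<..<l}) \<le> 2}"
  let ?B = "{l \<in> L. t < l \<and> card (L \<inter> {l<..<2 * l - t}) \<le> 2}"
  have "card ?A \<le> Suc 2"
  proof (rule card_le_if_few_below)
    show "card (?A \<inter> {..<x}) \<le> 2" if "x \<in> ?A" for x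
      by (rule le_trans[OF card_mono[of "L \<inter> {t<..<x}"]]) (use assms(1) that in auto)
  qed (use assms(1) in simp)
  \<comment> \<open>Measured from \<open>t\<close>, the interval from \<open>l\<close> to
    \<open>2 * l - t\<close> runs from \<open>x\<close> to \<open>2 * x\<close>.\<close>
  moreover have "card ((\<lambda>l. l - t) ` ?B) \<le> Suc 2 * k"
  proof (rule card_le_if_doubling)
    show "card ((\<lambda>l. l - t) ` ?B \<inter> {x<..<2 * x}) \<le> 2" if "x \<in> (\<lambda>l. l - t) ` ?B" for x
    proof -
      obtain l where l: "l \<in> ?B" "x = l - t"
        using \<open>x \<in> (\<lambda>l. l - t) ` ?B\<close> by blast
      have "(\<lambda>l. l - t) ` ?B \<inter> {x<..<2 * x} \<subseteq> (\<lambda>l. l - t) ` (L \<inter> {l<..<2 * l - t})"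
        using l by auto
      then have "card ((\<lambda>l. l - t) ` ?B \<inter> {x<..<2 * x}) \<le> card (L \<inter> {l<..<2 * l - t})"
        using assms(1) by (meson card_image_le card_mono finite_Int finite_imageI le_trans)
      with l show ?thesis
        by simp
    qed
  qed (use assms(2) in auto)
  then have "card ?B \<le> 3 * k"
    by (subst (asm) card_image) (auto simp: inj_on_def)
  moreover have "charged_above L t = ?A \<union> ?B"
    unfolding charged_above_def by blast
  ultimately show ?thesis
    using card_Un_le[of ?A ?B] by simp
qed

lemma card_charged:
  assumes "finite L" "\<And>l. l \<in> L \<Longrightarrow> \<bar>l - t\<bar> < 2 ^ k"
  shows "card (charged L t) \<le> 7 + 6 * k"
proof -
  have "card (charged_above L t) \<le> 3 + 3 * k" "card (charged_above (uminus ` L) (- t)) \<le> 3 + 3 * k"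
    using assms by (auto intro!: card_charged_above simp: abs_less_iff)
  moreover have "card (uminus ` charged_above (uminus ` L) (- t)) = card (charged_above (uminus ` L) (- t))"
    by (intro card_image) (auto simp: inj_on_def)
  moreover have "card (L \<inter> {t}) \<le> 1"
    by (simp add: card_gt_0_iff Int_insert_right)
  moreover have "card (charged L t) \<le> card (L \<inter> {t}) + card (charged_above L t)
      + card (uminus ` charged_above (uminus ` L) (- t))"
    unfolding charged_def by (meson add_le_mono1 card_Un_le le_trans)
  ultimately show ?thesis
    by linarith
qed

text \<open>Negation preserves cardinalities and turns these intervals into the ones of
  \<open>charged_above\<close> at \<open>- l\<close> and \<open>- t\<close>.\<close>

lemma mem_charged_belowI:
  assumes "l \<in> L" "l < t" "card (L \<inter> {l<..<t}) \<le> 2 \<or> card (L \<inter> {2 * l - t<..<l}) \<le> 2"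
  shows "l \<in> charged L t"
proof -
  have *: "uminus ` L \<inter> {- b<..<- a} = uminus ` (L \<inter> {a<..<b})" for a b :: int
    by force
  have "card (uminus ` L \<inter> {- b<..<- a}) = card (L \<inter> {a<..<b})" for a b :: int
    unfolding * by (intro card_image) (auto simp: inj_on_def)
  from this[of t l] this[of l "2 * l - t"] assms have "- l \<in> charged_above (uminus ` L) (- t)"
    by (auto simp: charged_above_def)
  then show ?thesis
    unfolding charged_def by force
qed

lemma mem_charged_aboveI:
  assumes "l \<in> L" "t < l" "card (L \<inter> {t<..<l}) \<le> 2 \<or> card (L \<inter> {l<..<2 * l - t}) \<le> 2"
  shows "l \<in> charged L t"
  using assms by (simp add: charged_def charged_above_def)

text \<open>\<open>X\<close>, \<open>s\<close> and \<open>Y\<close>, \<open>t\<close> are label sets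
  and thresholds of the two ends. Each bound concerns the threshold of the opposite end; every case
  shrinks one of these two intervals.\<close>

lemma edge_charged:
  assumes fin: "finite X" "finite Y" and l: "l \<in> X" "l \<in> Y" and le: "s \<le> t"
    and X: "card (X \<inter> {l<..<t}) \<le> 2" and Y: "card (Y \<inter> {s<..<l}) \<le> 2"
  shows "l \<in> charged X s \<or> l \<in> charged Y t"
proof -
  consider "l = s" | "l = t" | "l < s" | "t < l" | "s < l" "l < t" "2 * l \<le> s + t"
    | "s < l" "l < t" "s + t \<le> 2 * l"
    by linarith
  then show ?thesis
  proof cases
    case 3
    have "card (X \<inter> {l<..<s}) \<le> 2"
      by (rule le_trans[OF card_mono X]) (use fin le in auto)
    then show ?thesis
      using mem_charged_belowI l 3 by blast
  next
    case 4
    have "card (Y \<inter> {t<..<l}) \<le> 2"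
      by (rule le_trans[OF card_mono Y]) (use fin le in auto)
    then show ?thesis
      using mem_charged_aboveI l 4 by blast
  next
    case 5
    \<comment> \<open>Below the midpoint, \<open>2 * l - s\<close> does not exceed
      \<open>t\<close>.\<close>
    have "card (X \<inter> {l<..<2 * l - s}) \<le> 2"
      by (rule le_trans[OF card_mono X]) (use fin 5 in auto)
    then show ?thesis
      using mem_charged_aboveI l 5 by blast
  next
    case 6
    have "card (Y \<inter> {2 * l - t<..<l}) \<le> 2"
      by (rule le_trans[OF card_mono Y]) (use fin 6 in auto)
    then show ?thesis
      using mem_charged_belowI l 6 by blast
  qed (use l in \<open>simp_all add: charged_def\<close>)
qed

text \<open>Each label is charged to an end of its edge, so the sizes of the charged sets are summed
  over the vertices.\<close>

lemma card_labels_le: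
  fixes L :: "'v \<Rightarrow> int set" and T :: "'v \<Rightarrow> int"
  assumes V: "finite V" and L: "\<And>v. v \<in> V \<Longrightarrow> L v \<subseteq> {1..m}"
    and T: "\<And>v. v \<in> V \<Longrightarrow> T v \<in> {0..m + 1}" and m: "m < 2 ^ k"
    and S: "\<And>l. l \<in> S \<Longrightarrow> \<exists>x\<in>V. \<exists>y\<in>V. l \<in> L x \<and> l \<in> L y \<and>
       card (L y \<inter> {l<..<T x}) \<le> 2 \<and> card (L y \<inter> {T x<..<l}) \<le> 2 \<and>
       card (L x \<inter> {l<..<T y}) \<le> 2 \<and> card (L x \<inter> {T y<..<l}) \<le> 2"
  shows "card S \<le> card V * (7 + 6 * k)"
proof -
  have fin: "finite (L v)" if "v \<in> V" for v
    using L[OF that] finite_subset by blast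
  have "S \<subseteq> (\<Union>v\<in>V. charged (L v) (T v))"
  proof
    fix l assume "l \<in> S"
    then obtain x y where xy: "x \<in> V" "y \<in> V" "l \<in> L x" "l \<in> L y"
      "card (L y \<inter> {l<..<T x}) \<le> 2" "card (L y \<inter> {T x<..<l}) \<le> 2"
      "card (L x \<inter> {l<..<T y}) \<le> 2" "card (L x \<inter> {T y<..<l}) \<le> 2"
      using S by blast
    have "l \<in> charged (L x) (T x) \<or> l \<in> charged (L y) (T y)"
      \<comment> \<open>The two instances cover both orders of the thresholds.\<close>
      using edge_charged[of "L x" "L y" l "T x" "T y"] edge_charged[of "L y" "L x" l "T y" "T x"]
        xy fin linear[of "T x" "T y"] by blast
    then show "l \<in> (\<Union>v\<in>V. charged (L v) (T v))"
      using xy by blast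
  qed
  moreover have finc: "finite (charged (L v) (T v))" if "v \<in> V" for v
    using fin[OF that] by (simp add: charged_def charged_above_def)
  ultimately have "card S \<le> card (\<Union>v\<in>V. charged (L v) (T v))"
    using V by (intro card_mono) auto
  also have "\<dots> \<le> (\<Sum>v\<in>V. card (charged (L v) (T v)))"
    using V by (rule card_UN_le)
  also have "\<dots> \<le> (\<Sum>v\<in>V. 7 + 6 * k)"
  proof (rule sum_mono)
    fix v assume v: "v \<in> V"
    show "card (charged (L v) (T v)) \<le> 7 + 6 * k"
    proof (rule card_charged[OF fin[OF v]])
      \<comment> \<open>Labels from \<open>1\<close> to \<open>m\<close> and thresholds from
        \<open>0\<close> to \<open>m + 1\<close> differ by at most \<open>m\<close>.\<close>
      show "\<bar>l - T v\<bar> < 2 ^ k" if "l \<in> L v" for l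
        using L[OF v] T[OF v] that m by (auto simp: abs_less_iff)
    qed
  qed
  finally show ?thesis
    by simp
qed

section \<open>Existence of thresholds\<close>

lemma obtain_avoiding_two:
  assumes "3 \<le> card A"
  obtains l where "l \<in> A" "l \<noteq> p" "l \<noteq> q"
proof -
  have "\<not> A \<subseteq> {p, q}"
  proof
    assume "A \<subseteq> {p, q}"
    then have "card A \<le> card {p, q}"
      by (intro card_mono) auto
    also have "\<dots> \<le> 2"
      by (simp add: card_insert_if)
    finally show False
      using assms by simp
  qed
  then show thesis
    using that by blast
qed

definition labels_at :: "'a set set \<Rightarrow> ('a set \<Rightarrow> int) \<Rightarrow> 'a \<Rightarrow> int set" where
  "labels_at E lab v = lab ` {e \<in> E. v \<in> e}"

lemma labels_atE:
  assumes "l \<in> labels_at E lab v" "\<And>e. e \<in> E \<Longrightarrow> card e = 2"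
  obtains w where "l = lab {v, w}" "{v, w} \<in> E" "v \<noteq> w"
proof -
  obtain e where e: "e \<in> E" "v \<in> e" "l = lab e"
    using assms(1) by (auto simp: labels_at_def)
  then obtain a b where "e = {a, b}" "a \<noteq> b"
    using assms(2)[OF e(1)] by (auto simp: card_2_iff)
  with e show thesis
    using that[of a] that[of b] by (auto simp: insert_commute)
qed

text \<open>The threshold is the largest \<open>t\<close> satisfying the first bound at all neighbours. By maximality some
  neighbour \<open>y\<close> violates it at \<open>t + 1\<close>, so a neighbour violating the second bound at \<open>t\<close> would complete
  a path with middle vertex \<open>x\<close>. Three labels are needed to keep the end vertices distinct.\<close>

lemma threshold_exists:
  fixes lab :: "'a set \<Rightarrow> int"
  assumes E: "\<And>e. e \<in> E \<Longrightarrow> card e = 2" and lab: "\<And>e. e \<in> E \<Longrightarrow> lab e \<in> {1..m}" and m: "0 \<le> m"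
    and free: "\<And>a b c d e. distinct [a, b, c, d, e] \<Longrightarrow>
      {a, b} \<in> E \<Longrightarrow> {b, c} \<in> E \<Longrightarrow> {c, d} \<in> E \<Longrightarrow> {d, e} \<in> E \<Longrightarrow>
      lab {b, c} < lab {a, b} \<Longrightarrow> lab {a, b} < lab {d, e} \<Longrightarrow> lab {d, e} < lab {c, d} \<Longrightarrow> False"
  shows "\<exists>t\<in>{0..m + 1}. \<forall>y. {x, y} \<in> E \<longrightarrow>
      card (labels_at E lab y \<inter> {lab {x, y}<..<t}) \<le> 2 \<and>
      card (labels_at E lab y \<inter> {t<..<lab {x, y}}) \<le> 2"
proof -
  define P where "P t \<longleftrightarrow> (\<forall>y. {x, y} \<in> E \<longrightarrow>
      card (labels_at E lab y \<inter> {lab {x, y}<..<t}) \<le> 2)" for t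
  define t where "t = Max {t \<in> {0..m + 1}. P t}"
  \<comment> \<open>Labels are positive, so \<open>0\<close> is a candidate and the maximum
    exists.\<close>
  have "{lab {x, y}<..<0} = {}" if "{x, y} \<in> E" for y
    using lab[OF that] by auto
  then have "P 0"
    by (simp add: P_def)
  have fin: "finite {t \<in> {0..m + 1}. P t}"
    by (rule finite_subset[of _ "{0..m + 1}"]) auto
  have "t \<in> {t \<in> {0..m + 1}. P t}"
    unfolding t_def using \<open>P 0\<close> m by (intro Max_in fin) force
  then have t: "t \<in> {0..m + 1}" "P t"
    by auto
  have "card (labels_at E lab z \<inter> {t<..<lab {x, z}}) \<le> 2" if xz: "{x, z} \<in> E" for z
  proof (rule ccontr)
    assume "\<not> ?thesis"
    then have z: "3 \<le> card (labels_at E lab z \<inter> {t<..<lab {x, z}})"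
      by simp
    obtain l where "l \<in> {t<..<lab {x, z}}"
      using obtain_avoiding_two[OF z] by blast
    then have tz: "t < lab {x, z}"
      by auto
    then have "t + 1 \<in> {0..m + 1}"
      using t(1) lab[OF xz] by auto
    moreover have "t + 1 \<notin> {t \<in> {0..m + 1}. P t}"
      using Max_ge[OF fin, of "t + 1"] unfolding t_def by linarith
    ultimately have "\<not> P (t + 1)"
      by simp
    then obtain y where xy: "{x, y} \<in> E"
      and y: "3 \<le> card (labels_at E lab y \<inter> {lab {x, y}<..<t + 1})"
      unfolding P_def by force
    \<comment> \<open>Avoiding \<open>lab {z, y}\<close> yields \<open>e \<noteq> y\<close>; being
      below \<open>lab {x, z}\<close> yields \<open>e \<noteq> x\<close>.\<close>
    obtain l5 where l5: "l5 \<in> labels_at E lab z" "t < l5" "l5 < lab {x, z}" "l5 \<noteq> lab {z, y}"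
      using obtain_avoiding_two[OF z, of "lab {z, y}" "lab {z, y}"] by auto
    obtain e where e: "l5 = lab {z, e}" "{z, e} \<in> E" "z \<noteq> e"
      using labels_atE[OF l5(1) E] by blast
    \<comment> \<open>The two avoided labels yield \<open>a \<noteq> z\<close> and
      \<open>a \<noteq> e\<close>. The open bound \<open>t + 1\<close> means
      \<open>l1 \<le> t\<close>, hence \<open>l1 < l5\<close>.\<close>
    obtain l1 where l1: "l1 \<in> labels_at E lab y" "lab {x, y} < l1" "l1 \<le> t"
        "l1 \<noteq> lab {y, z}" "l1 \<noteq> lab {y, e}"
      using obtain_avoiding_two[OF y, of "lab {y, z}" "lab {y, e}"] by auto
    obtain a where a: "l1 = lab {y, a}" "{y, a} \<in> E" "y \<noteq> a"
      using labels_atE[OF l1(1) E] by blast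
    have "x \<noteq> y" "x \<noteq> z"
      using E[OF xy] E[OF xz] by auto
    moreover have "y \<noteq> z"
      using l1 tz by auto
    moreover have "a \<noteq> x" "a \<noteq> z" "a \<noteq> e" "e \<noteq> x" "e \<noteq> y"
      using l1 l5 a e by (auto simp: insert_commute)
    ultimately have "distinct [a, y, x, z, e]"
      using a(3) e(3) by auto
    moreover have "lab {y, x} < lab {a, y}" "lab {a, y} < lab {z, e}" "lab {z, e} < lab {x, z}"
      using l1 l5 a(1) e(1) by (simp_all add: insert_commute)
    ultimately show False
      using free[of a y x z e] xy xz a(2) e(2) by (simp add: insert_commute)
  qed
  then show ?thesis
    using t unfolding P_def by blast
qed

section \<open>From the edge order to the asymptotic upper bound\<close>

text \<open>The label is the rank, the number of elements not above \<open>e\<close>; counting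
  \<open>e\<close> itself makes it at least \<open>1\<close>.\<close>

lemma linear_order_label:
  assumes fin: "finite E" and lin: "linear_order_on E r"
  obtains lab :: "'a \<Rightarrow> int" where
    "\<And>e f. e \<in> E \<Longrightarrow> f \<in> E \<Longrightarrow> (e, f) \<in> r \<longleftrightarrow> lab e \<le> lab f"
    "\<And>e. e \<in> E \<Longrightarrow> lab e \<in> {1..int (card E)}"
proof -
  let ?D = "\<lambda>e. {e' \<in> E. (e', e) \<in> r}"
  have refl: "(e, e) \<in> r" if "e \<in> E" for e
    using lin that by (auto simp: order_on_defs refl_on_def)
  have trans: "trans r" and total: "total_on E r"
    using lin by (auto simp: order_on_defs)
  have mono: "card (?D e) \<le> card (?D f)" if "(e, f) \<in> r" for e f
    using fin trans that by (intro card_mono) (auto dest: transD)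
  have strict: "card (?D f) < card (?D e)" if ef: "e \<in> E" "f \<in> E" "(e, f) \<notin> r" for e f
  proof (rule psubset_card_mono)
    have "(f, e) \<in> r"
      using ef total refl unfolding total_on_def by metis
    then show "?D f \<subset> ?D e"
      using ef trans refl[OF ef(1)] by (auto dest: transD)
  qed (use fin in simp)
  show thesis
  proof (rule that[of "\<lambda>e. int (card (?D e))"])
    show "(e, f) \<in> r \<longleftrightarrow> int (card (?D e)) \<le> int (card (?D f))" if "e \<in> E" "f \<in> E" for e f
      using mono[of e f] strict[OF that] unfolding of_nat_le_iff by (meson leD)
    show "int (card (?D e)) \<in> {1..int (card E)}" if "e \<in> E" for e
    proof -
      have "?D e \<noteq> {}"
        using refl that by auto
      then have "0 < card (?D e)"
        using fin by (simp add: card_gt_0_iff)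
      moreover have "card (?D e) \<le> card E"
        using fin by (intro card_mono) auto
      ultimately show ?thesis
        by simp
    qed
  qed
qed

text \<open>Labels are injective, so counting labels counts edges; the thresholds feed
  \<open>card_labels_le\<close>.\<close>

lemma card_edges_le_if_free_2143:
  assumes G: "edge_ordered_graph G" and free: "\<not> eo_contains G (eo_path [2, 1, 4, 3])"
    and k: "card (edges G) < 2 ^ k"
  shows "card (edges G) \<le> card (verts G) * (7 + 6 * k)"
proof -
  let ?V = "verts G" and ?E = "edges G"
  have V: "finite ?V" and EV: "\<And>e. e \<in> ?E \<Longrightarrow> e \<subseteq> ?V" and E2: "\<And>e. e \<in> ?E \<Longrightarrow> card e = 2"
    and lin: "linear_order_on ?E (eord G)"
    using G by (auto simp: edge_ordered_graph_def)
  have "finite ?E"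
    by (rule finite_subset[of _ "Pow ?V"]) (use V EV in auto)
  then obtain lab :: "'a set \<Rightarrow> int" where
    lab: "\<And>e f. e \<in> ?E \<Longrightarrow> f \<in> ?E \<Longrightarrow> (e, f) \<in> eord G \<longleftrightarrow> lab e \<le> lab f"
    and bound: "\<And>e. e \<in> ?E \<Longrightarrow> lab e \<in> {1..int (card ?E)}"
    using linear_order_label[OF _ lin] by blast
  have inj: "inj_on lab ?E"
  proof (rule inj_onI)
    fix e f assume "e \<in> ?E" "f \<in> ?E" "lab e = lab f"
    then show "e = f"
      using lab[of e f] lab[of f e] lin by (auto simp: order_on_defs dest: antisymD)
  qed
  have no_path: False if "distinct [a, b, c, d, e]"
    "{a, b} \<in> ?E" "{b, c} \<in> ?E" "{c, d} \<in> ?E" "{d, e} \<in> ?E"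
    "lab {b, c} < lab {a, b}" "lab {a, b} < lab {d, e}" "lab {d, e} < lab {c, d}" for a b c d e
  proof -
    have "path_embedding G [2, 1, 4, 3] [a, b, c, d, e]"
      using that EV[OF that(2)] EV[OF that(3)] EV[OF that(4)] EV[OF that(5)]
      by (simp add: path_embedding_def All_less_Suc lab)
    with path_embedding_imp_eo_contains[OF G] free show False
      by blast
  qed
  have "\<exists>t\<in>{0..int (card ?E) + 1}. \<forall>y. {x, y} \<in> ?E \<longrightarrow>
      card (labels_at ?E lab y \<inter> {lab {x, y}<..<t}) \<le> 2 \<and>
      card (labels_at ?E lab y \<inter> {t<..<lab {x, y}}) \<le> 2" for x
    by (rule threshold_exists[OF E2 bound]) (assumption, assumption, simp, erule (7) no_path)
  then obtain T where T: "\<And>x. T x \<in> {0..int (card ?E) + 1}"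
    "\<And>x y. {x, y} \<in> ?E \<Longrightarrow> card (labels_at ?E lab y \<inter> {lab {x, y}<..<T x}) \<le> 2 \<and>
      card (labels_at ?E lab y \<inter> {T x<..<lab {x, y}}) \<le> 2"
    by metis
  have "card (lab ` ?E) \<le> card ?V * (7 + 6 * k)"
  proof (rule card_labels_le[OF V _ T(1), of "labels_at ?E lab"])
    show "labels_at ?E lab v \<subseteq> {1..int (card ?E)}" for v
      using bound by (auto simp: labels_at_def)
    show "int (card ?E) < 2 ^ k"
      using k by (metis of_nat_less_iff of_nat_numeral of_nat_power)
    fix l assume "l \<in> lab ` ?E"
    then obtain e where "e \<in> ?E" "l = lab e"
      by blast
    then obtain x y where xy: "{x, y} \<in> ?E" "l = lab {x, y}"
      using E2 by (metis card_2_iff)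
    then have "x \<in> ?V" "y \<in> ?V" "l \<in> labels_at ?E lab x" "l \<in> labels_at ?E lab y"
      using EV by (auto simp: labels_at_def)
    moreover have "{y, x} \<in> ?E" "l = lab {y, x}"
      using xy by (simp_all add: insert_commute)
    ultimately show "\<exists>x\<in>?V. \<exists>y\<in>?V. l \<in> labels_at ?E lab x \<and> l \<in> labels_at ?E lab y \<and>
       card (labels_at ?E lab y \<inter> {l<..<T x}) \<le> 2 \<and> card (labels_at ?E lab y \<inter> {T x<..<l}) \<le> 2 \<and>
       card (labels_at ?E lab x \<inter> {l<..<T y}) \<le> 2 \<and> card (labels_at ?E lab x \<inter> {T y<..<l}) \<le> 2"
      using T(2)[of x y] T(2)[of y x] xy by metis
  qed
  then show ?thesis
    using inj by (simp add: card_image)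
qed

text \<open>This crude bound makes the exponent in the previous estimate logarithmic in the number
  of vertices.\<close>

lemma card_edges_le_square:
  assumes "edge_ordered_graph G"
  shows "card (edges G) \<le> (card (verts G))\<^sup>2"
proof -
  have V: "finite (verts G)" and E: "edges G \<subseteq> {e. e \<subseteq> verts G \<and> card e = 2}"
    using assms by (auto simp: edge_ordered_graph_def)
  have "edges G \<subseteq> (\<lambda>(u, v). {u, v}) ` (verts G \<times> verts G)"
    using E by (fastforce simp: card_2_iff)
  then have "card (edges G) \<le> card (verts G \<times> verts G)"
    using V by (intro surj_card_le) auto
  then show ?thesis
    by (simp add: card_cartesian_product power2_eq_square)
qed

lemma ex_lt_attained:
  assumes "edge_ordered_graph H" "edges H \<noteq> {}"
  obtains G :: "nat eograph" where "edge_ordered_graph G" "card (verts G) = n"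
    "\<not> eo_contains G H" "ex_lt n H = card (edges G)"
  using Max_in[OF finite_ex_lt_values ex_lt_values_nonempty[OF assms], of n]
  by (auto simp: ex_lt_values_def ex_lt_def)

lemma bigo_ex_lt_2143:
  "(\<lambda>n. real (ex_lt n (eo_path [2, 1, 4, 3]))) \<in> O(\<lambda>n. real n * ln (real n))"
\<comment> \<open>The exponent \<open>2 * (k + 1)\<close> gives \<open>19 + 12 * k\<close> edges per
  vertex; both \<open>1\<close> and \<open>k\<close> are at most the binary logarithm of
  \<open>n\<close>, and \<open>19 + 12 = 31\<close>.\<close>
proof (rule landau_o.bigI[of "31 / ln 2"])
  let ?H = "eo_path [2, 1, 4, 3]"
  show "eventually (\<lambda>n. norm (real (ex_lt n ?H)) \<le> 31 / ln 2 * norm (real n * ln (real n))) at_top"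
  proof (rule eventually_mono[OF eventually_ge_at_top[of 2]])
    fix n :: nat assume n: "2 \<le> n"
    have "edge_ordered_graph ?H"
      by (intro edge_ordered_graph_eo_path) simp
    moreover have "{0, Suc 0} \<in> edges ?H"
      by (auto simp: eo_path_def)
    ultimately obtain G :: "nat eograph" where G: "edge_ordered_graph G" "card (verts G) = n"
      "\<not> eo_contains G ?H" "ex_lt n ?H = card (edges G)"
      using ex_lt_attained[of ?H n] by blast
    obtain k where k: "2 ^ k \<le> n" "n < 2 ^ (k + 1)"
      using ex_power_ivl1[of 2 n] n by auto
    have "card (edges G) \<le> n\<^sup>2"
      using card_edges_le_square[OF G(1)] G(2) by simp
    also have "\<dots> < (2 ^ (k + 1))\<^sup>2"
      using k(2) by (intro power_strict_mono) auto
    also have "\<dots> = 2 ^ (2 * (k + 1))"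
      by (simp add: power_mult power_mult_distrib flip: power_mult)
    finally have "card (edges G) \<le> n * (7 + 6 * (2 * (k + 1)))"
      using card_edges_le_if_free_2143[OF G(1,3)] G(2) by blast
    then have "real (ex_lt n ?H) \<le> real (n * (7 + 6 * (2 * (k + 1))))"
      unfolding G(4) of_nat_le_iff .
    also have "\<dots> = real n * (19 + 12 * real k)"
      by (simp add: algebra_simps)
    also have "\<dots> \<le> real n * (31 * (ln n / ln 2))"
    proof (rule mult_left_mono)
      have "real (2 ^ k) \<le> real n"
        unfolding of_nat_le_iff by (rule k(1))
      then have "ln (2 ^ k) \<le> ln (real n)"
        by (intro ln_mono) simp_all
      then have "real k * ln 2 \<le> ln (real n)"
        by (simp add: ln_realpow)
      then have "real k \<le> ln n / ln 2"
        by (simp add: field_simps)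
      moreover have "ln 2 \<le> ln (real n)"
        using n by (intro ln_mono) simp_all
      then have "1 \<le> ln n / ln 2"
        by (simp add: field_simps)
      ultimately show "19 + 12 * real k \<le> 31 * (ln n / ln 2)"
        by linarith
    qed simp
    finally show "norm (real (ex_lt n ?H)) \<le> 31 / ln 2 * norm (real n * ln (real n))"
      using n by (simp add: abs_mult field_simps)
  qed
qed simp

theorem theorem4p11:
  shows "(\<lambda>n. real (ex_lt n (eo_path [1, 3, 4, 2]))) \<in> \<Omega>(\<lambda>n. real n * ln (real n)) \<and>
         (\<lambda>n. real (ex_lt n (eo_path [2, 1, 4, 3]))) \<in> \<Theta>(\<lambda>n. real n * ln (real n))"
proof
  show "(\<lambda>n. real (ex_lt n (eo_path [1, 3, 4, 2]))) \<in> \<Omega>(\<lambda>n. real n * ln (real n))"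
    by (rule bigomega_if_cube_graph_free[OF _ cube_graph_free_1342]) simp
  have "(\<lambda>n. real (ex_lt n (eo_path [2, 1, 4, 3]))) \<in> \<Omega>(\<lambda>n. real n * ln (real n))"
    by (rule bigomega_if_cube_graph_free[OF _ cube_graph_free_2143]) auto
  with bigo_ex_lt_2143
  show "(\<lambda>n. real (ex_lt n (eo_path [2, 1, 4, 3]))) \<in> \<Theta>(\<lambda>n. real n * ln (real n))"
    by (rule bigthetaI)
qed

end
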